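(* For $j=1,\dots,k$, we have \[ R_n^{(j)}(\tilde P_n^{(j)}(P),\tilde P_n)=R^{(1)}(\tilde P_n^{(1)}\cdots\tilde P_n^{(j)}(P),\tilde P_n)-\tilde P_nD^{(1)}_{\tilde P_n^{(1)}\cdots\tilde P_n^{(j)}(P)}+\tilde P_nD^{(j)}_{n,\tilde P_n^{(j)}(P)}. \] As a consequence, for $j=1,\dots,k-1$, we have \[ R_n^{(j+1)}(\tilde P_n^{(j+1)}(P),\tilde P_n)=R_n^{(j)}(\tilde P_n^{(j)}(\tilde P_n^{(j+1)}(P)),\tilde P_n)-\tilde P_nD^{(j)}_{n,\tilde P_n^{(j)}\tilde P_n^{(j+1)}(P)}+\tilde P_nD^{(j+1)}_{n,\tilde P_n^{(j+1)}(P)}. \] Also, \[ \begin{aligned} \Psi_n^{(j)}(P)-\Psi_n^{(j)}(\tilde P_n)&=\Psi_n^{(j-1)}(\tilde P_n^{(j)}(P))-\Psi_n^{(j-1)}(\tilde P_n)\\ &=-\tilde P_nD^{(j)}_{n,\tilde P_n^{(j)}(P)}+R_n^{(j)}(\tilde P_n^{(j)}(P),\tilde P_n)\\ &\approx R_n^{(j)}(\tilde P_n^{(j)}(P),\tilde P_n), \end{aligned} \] where the latter is an exact equality if $\tilde P_n^{(j)}(P)$ solves $\tilde P_nD^{(j)}_{n,\tilde P_n^{(j)}(P)}=0$ exactly. Thus, a TMLE $\tilde P_n^{(j+1)}(P_n^0)$ targeting $\Psi_n^{(j)}(P_0)$ is equivalent with a TMLE targeting $R_n^{(j)}(\tilde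 P_n^{(j)}(P_0),\tilde P_n)$.
   Context: $O_1,\dots,O_n$ are i.i.d. from $P_0\in{\cal M}$, where the model ${\cal M}$ is a set of probability distributions dominated by a measure $\mu$ (densities $p=dP/d\mu$). $Pf=\int f\,dP$. $L(P)=-\log p$. A functional $\Phi:{\cal M}\to\mathbb R$ is pathwise differentiable at $P$ with canonical gradient $D_P$ if for every path $\{P_{\delta,h}\}\subset{\cal M}$ in a given class, through $P$ at $\delta=0$ with score $h$, $\frac{d}{d\delta}\Phi(P_{\delta,h})|_{\delta=0}=P D_Ph$, with $D_P$ in the tangent space $T_P({\cal M})\subset L^2_0(P)$ (closure of the linear span of the scores). $\Psi:{\cal M}\to\mathbb R$ is pathwise differentiable with canonical gradient $D^{(1)}_P$. $\tilde P_n\in{\cal M}$ is the HAL-MLE: a data-dependent maximum likelihood estimator of $P_0$ over the elements of ${\cal M}$ for which the cadlag function parametrizing the density has variation norm bounded by a constant; $d\tilde P_n/dP$ exists at all $P$ used. Recursively, put $\Psi_n^{(0)}=\Psi$, $D^{(1)}_{n,P}=D^{(1)}_P$. For $j\ge1$: $D^{(j)}_{n,P}$ is the canonical gradient of $\Psi_n^{(j-1)}$ at $P$; $\{\tilde P_n^{(j)}(P,\epsilon):\epsilon\}\subset{\cal M}$ is a least favorable path through $P$ at $\epsilon=0$ whose scores at $\epsilon=0$ span $D^{(j)}_{n,P}$; $\epsilon_n^{(j)}(P)$ is either $\arg\min_\epsilon\tilde P_nL(\tilde P_n^{(j)}(P,\epsilon))$ or a solution of $\tilde P_nD^{(j)}_{n,\tilde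 P_n^{(j)}(P,\epsilon)}=0$; $\tilde P_n^{(j)}(P)=\tilde P_n^{(j)}(P,\epsilon_n^{(j)}(P))$ is the HAL-regularized TMLE update (targeted maximum likelihood estimator targeting $\Psi_n^{(j-1)}(P_0)$ with initial $P$), tailored to solve $\tilde P_nD^{(j)}_{n,\tilde P_n^{(j)}(P)}\approx0$ at user-supplied precision; and $\Psi_n^{(j)}(P)=\Psi_n^{(j-1)}(\tilde P_n^{(j)}(P))$. The HAL-MLE is a fixed point of the updates: $\tilde P_n^{(j)}(\tilde P_n)=\tilde P_n$. The exact remainder is $R_n^{(j)}(P,P')=\Psi_n^{(j-1)}(P)-\Psi_n^{(j-1)}(P')+P'D^{(j)}_{n,P}$, and $R^{(1)}=R_n^{(1)}$. $P_n^0\in{\cal M}$ is an initial estimator of $P_0$; $P$ denotes an element of ${\cal M}$. Juxtaposition of update maps denotes composition. *)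

theory Defs
  imports "HOL-Probability.Probability"
begin

text \<open>
  The set \<open>s\<close> collects the coordinates in which the quadrant lies strictly below \<open>u\<close>. A function on
  the cube from \<open>0\<close> to \<open>\<tau>\<close> is cadlag if it has a limit at \<open>u\<close> from within each quadrant and is
  continuous at \<open>u\<close> from within the upper one. A quadrant not accumulating at \<open>u\<close> imposes nothing.
\<close>

definition quadrant :: "real ^ 'd \<Rightarrow> 'd set \<Rightarrow> real ^ 'd \<Rightarrow> (real ^ 'd) set" where
  "quadrant \<tau> s u = {v \<in> cbox 0 \<tau>. \<forall>i. (i \<in> s \<longrightarrow> v $ i < u $ i) \<and> (i \<notin> s \<longrightarrow> u $ i \<le> v $ i)}"

definition cadlag_on :: "real ^ 'd \<Rightarrow> (real ^ 'd \<Rightarrow> real) \<Rightarrow> bool" where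
  "cadlag_on \<tau> f \<longleftrightarrow>
     (\<forall>u\<in>cbox 0 \<tau>. (\<forall>s. \<exists>l. (f \<longlongrightarrow> l) (at u within quadrant \<tau> s u)) \<and>
                  (f \<longlongrightarrow> f u) (at u within quadrant \<tau> {} u))"

text \<open>
  The \<open>s\<close>-section of \<open>f\<close> sets the coordinates outside \<open>s\<close> to \<open>0\<close>. \<open>section_variation\<close> is the Vitali
  variation of that section: the supremum over grids \<open>0 = g i 0 \<le> \<dots> \<le> g i m = \<tau>\<^sub>i\<close> of the sum of the
  absolute generalized increments over the cells. Grids are weakly increasing, so a common \<open>m\<close> for all
  coordinates is no restriction. For \<open>s = {}\<close> there is a single cell, with increment \<open>f 0\<close>; the sum over
  all \<open>s\<close> is thus \<open>\<bar>f 0\<bar>\<close> plus the variations of all sections with \<open>s\<close> nonempty.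
\<close>

definition section_increment ::
    "(real ^ 'd \<Rightarrow> real) \<Rightarrow> 'd set \<Rightarrow> ('d \<Rightarrow> real) \<Rightarrow> ('d \<Rightarrow> real) \<Rightarrow> real" where
  "section_increment f s a b =
     (\<Sum>t\<in>Pow s. (- 1) ^ card (s - t) * f (\<chi> i. if i \<in> t then b i else if i \<in> s then a i else 0))"

definition section_variation :: "real ^ 'd \<Rightarrow> (real ^ 'd \<Rightarrow> real) \<Rightarrow> 'd set \<Rightarrow> ennreal" where
  "section_variation \<tau> f s =
     (SUP (m, g) \<in> {(m, g). \<forall>i. mono (g i) \<and> g i (0::nat) = 0 \<and> g i m = \<tau> $ i}.
        \<Sum>c\<in>Pi\<^sub>E s (\<lambda>_. {..<m}).
          ennreal \<bar>section_increment f s (\<lambda>i. g i (c i)) (\<lambda>i. g i (Suc (c i)))\<bar>)"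

definition variation_norm :: "real ^ 'd \<Rightarrow> (real ^ 'd \<Rightarrow> real) \<Rightarrow> ennreal" where
  "variation_norm \<tau> f = (\<Sum>s\<in>UNIV. section_variation \<tau> f s)"

text \<open>
  \<open>p P\<close> is a fixed version of the density of \<open>P\<close>: likelihoods are evaluated at observed points,
  so a density known only almost everywhere would not do. It depends on \<open>P\<close> through the cadlag
  function \<open>q P\<close>, by way of the density map \<open>dens\<close>.
\<close>

definition dominated_model ::
    "'o measure \<Rightarrow> 'o measure set \<Rightarrow> ('o measure \<Rightarrow> 'o \<Rightarrow> real) \<Rightarrow> bool" where
  "dominated_model \<mu> \<M> p \<longleftrightarrow>
     (\<forall>P\<in>\<M>. prob_space P \<and> p P \<in> borel_measurable \<mu> \<and> (\<forall>x. 0 \<le> p P x) \<and>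
            P = density \<mu> (\<lambda>x. ennreal (p P x)))"

definition cadlag_parametrization ::
    "'o measure set \<Rightarrow> ('o measure \<Rightarrow> 'o \<Rightarrow> real) \<Rightarrow> real ^ 'd \<Rightarrow>
     ('o measure \<Rightarrow> real ^ 'd \<Rightarrow> real) \<Rightarrow> ((real ^ 'd \<Rightarrow> real) \<Rightarrow> 'o \<Rightarrow> real) \<Rightarrow> bool" where
  "cadlag_parametrization \<M> p \<tau> q dens \<longleftrightarrow>
     (\<forall>i. 0 < \<tau> $ i) \<and> (\<forall>P\<in>\<M>. cadlag_on \<tau> (q P) \<and> p P = dens (q P))"

definition hal_mle ::
    "'o measure set \<Rightarrow> ('o measure \<Rightarrow> 'o \<Rightarrow> real) \<Rightarrow> real ^ 'd \<Rightarrow>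
     ('o measure \<Rightarrow> real ^ 'd \<Rightarrow> real) \<Rightarrow> real \<Rightarrow> nat \<Rightarrow> (nat \<Rightarrow> 'o) \<Rightarrow> 'o measure \<Rightarrow> bool" where
  "hal_mle \<M> p \<tau> q B n obs Q \<longleftrightarrow>
     Q \<in> \<M> \<and> variation_norm \<tau> (q Q) \<le> ennreal B \<and>
     (\<forall>P\<in>\<M>. variation_norm \<tau> (q P) \<le> ennreal B \<longrightarrow>
        (\<Prod>i\<in>{1..n}. p P (obs i)) \<le> (\<Prod>i\<in>{1..n}. p Q (obs i)))"

text \<open>The loss is infinite where the density vanishes, whereas \<open>ln 0 = 0\<close> in the library.\<close>

definition loss :: "('o measure \<Rightarrow> 'o \<Rightarrow> real) \<Rightarrow> 'o measure \<Rightarrow> 'o \<Rightarrow> ereal" where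
  "loss p P x = (if 0 < p P x then ereal (- ln (p P x)) else \<infinity>)"

text \<open>
  \<open>risk p Q P\<close> is the \<open>Q\<close>-expectation of the loss at \<open>P\<close>, as positive part minus negative part
  (\<open>e2ennreal\<close> maps negative values to \<open>0\<close>). If both are infinite, the value is \<open>\<infinity>\<close>.
\<close>

definition risk :: "('o measure \<Rightarrow> 'o \<Rightarrow> real) \<Rightarrow> 'o measure \<Rightarrow> 'o measure \<Rightarrow> ereal" where
  "risk p Q P = enn2ereal (\<integral>\<^sup>+x. e2ennreal (loss p P x) \<partial>Q) - enn2ereal (\<integral>\<^sup>+x. e2ennreal (- loss p P x) \<partial>Q)"

definition L20 :: "'o measure \<Rightarrow> ('o \<Rightarrow> real) set" where
  "L20 P = {h. h \<in> borel_measurable P \<and> integrable P (\<lambda>x. (h x)\<^sup>2) \<and> (\<integral>x. h x \<partial>P) = 0}"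

definition has_score ::
    "('o measure \<Rightarrow> 'o \<Rightarrow> real) \<Rightarrow> (real \<Rightarrow> 'o measure) \<Rightarrow> 'o measure \<Rightarrow> ('o \<Rightarrow> real) \<Rightarrow> bool" where
  "has_score p \<gamma> P h \<longleftrightarrow>
     h \<in> L20 P \<and>
     (AE x in P. (\<forall>\<^sub>F \<delta> in nhds 0. 0 < p (\<gamma> \<delta>) x) \<and>
                 ((\<lambda>\<delta>. ln (p (\<gamma> \<delta>) x)) has_real_derivative h x) (at 0))"

definition path_class ::
    "'o measure set \<Rightarrow> ('o measure \<Rightarrow> 'o \<Rightarrow> real) \<Rightarrow> ('o measure \<Rightarrow> (real \<Rightarrow> 'o measure) set) \<Rightarrow> bool" where
  "path_class \<M> p paths \<longleftrightarrow>
     (\<forall>P\<in>\<M>. \<forall>\<gamma>\<in>paths P. \<gamma> 0 = P \<and> (\<forall>\<^sub>F \<delta> in nhds 0. \<gamma> \<delta> \<in> \<M>) \<and> (\<exists>h. has_score p \<gamma> P h))"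

definition scores ::
    "('o measure \<Rightarrow> 'o \<Rightarrow> real) \<Rightarrow> ('o measure \<Rightarrow> (real \<Rightarrow> 'o measure) set) \<Rightarrow> 'o measure \<Rightarrow>
     ('o \<Rightarrow> real) set" where
  "scores p paths P = {h. \<exists>\<gamma>\<in>paths P. has_score p \<gamma> P h}"

definition tangent_space ::
    "('o measure \<Rightarrow> 'o \<Rightarrow> real) \<Rightarrow> ('o measure \<Rightarrow> (real \<Rightarrow> 'o measure) set) \<Rightarrow> 'o measure \<Rightarrow>
     ('o \<Rightarrow> real) set" where
  "tangent_space p paths P =
     {t \<in> L20 P. \<forall>e>0. \<exists>F c. finite F \<and> F \<subseteq> scores p paths P \<and>
                       (\<integral>x. (t x - (\<Sum>h\<in>F. c h * h x))\<^sup>2 \<partial>P) < e}"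

definition canonical_gradient ::
    "('o measure \<Rightarrow> 'o \<Rightarrow> real) \<Rightarrow> ('o measure \<Rightarrow> (real \<Rightarrow> 'o measure) set) \<Rightarrow>
     ('o measure \<Rightarrow> real) \<Rightarrow> 'o measure \<Rightarrow> ('o \<Rightarrow> real) \<Rightarrow> bool" where
  "canonical_gradient p paths \<Phi> P D \<longleftrightarrow>
     D \<in> tangent_space p paths P \<and>
     (\<forall>\<gamma>\<in>paths P. \<forall>h. has_score p \<gamma> P h \<longrightarrow>
        ((\<lambda>\<delta>. \<Phi> (\<gamma> \<delta>)) has_real_derivative (\<integral>x. D x * h x \<partial>P)) (at 0))"

text \<open>
  \<open>E P\<close> is the parameter set of the path \<open>lf P\<close>. The parameter may be multivariate; the scores at \<open>0\<close>
  are then those of the coordinate directions, and \<open>D P\<close> lies in their linear span.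
\<close>

definition least_favorable ::
    "'o measure set \<Rightarrow> ('o measure \<Rightarrow> 'o \<Rightarrow> real) \<Rightarrow> ('o measure \<Rightarrow> 'o \<Rightarrow> real) \<Rightarrow>
     ('o measure \<Rightarrow> 'e::euclidean_space set) \<Rightarrow> ('o measure \<Rightarrow> 'e \<Rightarrow> 'o measure) \<Rightarrow> bool" where
  "least_favorable \<M> p D E lf \<longleftrightarrow>
     (\<forall>P\<in>\<M>. 0 \<in> interior (E P) \<and> (\<forall>\<epsilon>\<in>E P. lf P \<epsilon> \<in> \<M>) \<and> lf P 0 = P \<and>
        (\<exists>S c. (\<forall>b\<in>Basis. has_score p (\<lambda>\<delta>. lf P (\<delta> *\<^sub>R b)) P (S b)) \<and>
               (AE x in P. D P x = (\<Sum>b\<in>Basis. c b * S b x))))"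

definition minimizes_risk ::
    "('o measure \<Rightarrow> 'o \<Rightarrow> real) \<Rightarrow> 'o measure \<Rightarrow> 'e set \<Rightarrow> ('e \<Rightarrow> 'o measure) \<Rightarrow> 'e \<Rightarrow> bool" where
  "minimizes_risk p Q E \<gamma> \<epsilon> \<longleftrightarrow>
     \<bar>risk p Q (\<gamma> \<epsilon>)\<bar> \<noteq> \<infinity> \<and> (\<forall>\<epsilon>'\<in>E. risk p Q (\<gamma> \<epsilon>) \<le> risk p Q (\<gamma> \<epsilon>'))"

text \<open>
  \<open>hal_tmle \<M> p paths Q \<Phi> D E lf eps tol\<close>: the map sending \<open>P\<close> to \<open>lf P (eps P)\<close> is a TMLE update
  targeting \<open>\<Phi>\<close>, with the HAL-MLE \<open>Q\<close> in the role of the empirical measure. It solves the equation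
  \<open>Q D = 0\<close> up to the user-supplied precision \<open>tol\<close>. Integrability is stated separately because
  non-integrable functions have integral \<open>0\<close> in the library.
\<close>

definition hal_tmle ::
    "'o measure set \<Rightarrow> ('o measure \<Rightarrow> 'o \<Rightarrow> real) \<Rightarrow> ('o measure \<Rightarrow> (real \<Rightarrow> 'o measure) set) \<Rightarrow>
     'o measure \<Rightarrow> ('o measure \<Rightarrow> real) \<Rightarrow> ('o measure \<Rightarrow> 'o \<Rightarrow> real) \<Rightarrow>
     ('o measure \<Rightarrow> 'e::euclidean_space set) \<Rightarrow> ('o measure \<Rightarrow> 'e \<Rightarrow> 'o measure) \<Rightarrow>
     ('o measure \<Rightarrow> 'e) \<Rightarrow> real \<Rightarrow> bool" where
  "hal_tmle \<M> p paths Q \<Phi> D E lf eps tol \<longleftrightarrow>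
     (\<forall>P\<in>\<M>. canonical_gradient p paths \<Phi> P (D P)) \<and>
     least_favorable \<M> p D E lf \<and>
     (\<forall>P\<in>\<M>. eps P \<in> E P \<and>
        integrable Q (D (lf P (eps P))) \<and>
        (minimizes_risk p Q (E P) (lf P) (eps P) \<or> (\<integral>x. D (lf P (eps P)) x \<partial>Q) = 0) \<and>
        \<bar>\<integral>x. D (lf P (eps P)) x \<partial>Q\<bar> \<le> tol)"

primrec target :: "('m \<Rightarrow> real) \<Rightarrow> (nat \<Rightarrow> 'm \<Rightarrow> 'm) \<Rightarrow> nat \<Rightarrow> 'm \<Rightarrow> real" where
  "target \<Psi> T 0 = \<Psi>"
| "target \<Psi> T (Suc j) = (\<lambda>P. target \<Psi> T j (T (Suc j) P))"

text \<open>\<open>comp_updates T j\<close> is \<open>T 1 \<circ> \<dots> \<circ> T j\<close>; the map with the largest index is applied first.\<close>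

primrec comp_updates :: "(nat \<Rightarrow> 'm \<Rightarrow> 'm) \<Rightarrow> nat \<Rightarrow> 'm \<Rightarrow> 'm" where
  "comp_updates T 0 = id"
| "comp_updates T (Suc j) = comp_updates T j \<circ> T (Suc j)"

definition exact_remainder ::
    "('o measure \<Rightarrow> real) \<Rightarrow> ('o measure \<Rightarrow> 'o \<Rightarrow> real) \<Rightarrow> 'o measure \<Rightarrow> 'o measure \<Rightarrow> real" where
  "exact_remainder \<Phi> D P P' = \<Phi> P - \<Phi> P' + (\<integral>x. D P x \<partial>P')"

end

theory Submission
  imports Defs
begin

text \<open>
  Two facts carry everything. The recursion for the targets composes the updates, so that
  \<open>\<Psi>\<^sub>n\<^sup>j = \<Psi> \<circ> T\<^sub>1 \<circ> \<dots> \<circ> T\<^sub>j\<close> (\<open>target_eq_comp_updates\<close>); and the HAL-MLE \<open>Q\<close> is a fixed point of every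
  update, hence \<open>\<Psi>\<^sub>n\<^sup>j Q = \<Psi> Q\<close> for all \<open>j\<close> (\<open>target_fixed_point\<close>). The exact remainder of
  order \<open>j\<close> at \<open>T\<^sub>j P\<close> is therefore \<open>\<Psi>\<^sub>n\<^sup>j P - \<Psi> Q\<close> plus the score term \<open>Q D\<^sub>j\<close> evaluated at \<open>T\<^sub>j P\<close>
  (\<open>exact_remainder_update\<close>). Remainders of different orders, taken at points that the composed
  updates send to the same distribution, thus differ only in their score terms, and this is what the
  first two identities say. Rearranged, the same formula is the expansion of \<open>\<Psi>\<^sub>n\<^sup>j\<close>, whose error is
  the score term that the TMLE keeps below the chosen precision.

  If the update of order \<open>j\<close> solves its score equation exactly throughout the model, then
  \<open>P \<mapsto> R\<^sub>j (T\<^sub>j P, Q)\<close> and \<open>\<Psi>\<^sub>n\<^sup>j\<close> differ on the model by the constant \<open>\<Psi> Q\<close>. A pathwise derivative does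
  not see a constant, so both functionals have the same canonical gradients; since a TMLE depends on
  its target only through the gradient, they have the same TMLEs (\<open>hal_tmle_shift\<close>).
\<close>

lemma target_eq_comp_updates: "target \<Psi> T j P = \<Psi> (comp_updates T j P)"
  by (induction j arbitrary: P) simp_all

lemma comp_updates_fixed_point:
  assumes "\<And>i. i \<in> {1..j} \<Longrightarrow> T i Q = Q"
  shows "comp_updates T j Q = Q"
  using assms by (induction j) simp_all

lemma target_fixed_point:
  assumes "\<And>i. i \<in> {1..j} \<Longrightarrow> T i Q = Q"
  shows "target \<Psi> T j Q = \<Psi> Q"
  using comp_updates_fixed_point[of j T Q] assms by (simp add: target_eq_comp_updates)

text \<open>
  The remainder of order \<open>j\<close> is built from the target of order \<open>j - 1\<close>, but at an updated
  distribution \<open>T\<^sub>j P\<close> that target is the target of order \<open>j\<close> at \<open>P\<close>; the centring value at the fixed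
  point is the same for every order.
\<close>

lemma exact_remainder_update:
  assumes "1 \<le> j" and "\<And>i. i \<in> {1..j} \<Longrightarrow> T i Q = Q"
  shows "exact_remainder (target \<Psi> T (j - 1)) D (T j P) Q =
    target \<Psi> T j P - \<Psi> Q + (\<integral>x. D (T j P) x \<partial>Q)"
proof -
  obtain i where j: "j = Suc i"
    using assms(1) by (cases j) auto
  have "target \<Psi> T i Q = \<Psi> Q"
    using assms(2) by (intro target_fixed_point) (simp add: j)
  then show ?thesis
    by (simp add: exact_remainder_def j)
qed

lemma hal_tmle_update_in_model:
  assumes "hal_tmle \<M> p paths Q \<Phi> D E lf eps tol" and "P \<in> \<M>"
  shows "lf P (eps P) \<in> \<M>"
  using assms by (auto simp: hal_tmle_def least_favorable_def)

lemma hal_tmle_score_bound: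
  assumes "hal_tmle \<M> p paths Q \<Phi> D E lf eps tol" and "P \<in> \<M>"
  shows "\<bar>\<integral>x. D (lf P (eps P)) x \<partial>Q\<bar> \<le> tol"
  using assms by (auto simp: hal_tmle_def)

text \<open>
  Agreement on the model up to a constant is enough because an admissible path stays in the model
  near \<open>\<delta> = 0\<close>, and a derivative at \<open>0\<close> depends only on values there.
\<close>

lemma canonical_gradient_shift_imp:
  assumes "path_class \<M> p paths" and "P \<in> \<M>"
    and shift: "\<And>P. P \<in> \<M> \<Longrightarrow> \<Phi>' P = \<Phi> P + c"
    and grad: "canonical_gradient p paths \<Phi> P D"
  shows "canonical_gradient p paths \<Phi>' P D"
  unfolding canonical_gradient_def
proof (intro conjI ballI allI impI)
  show "D \<in> tangent_space p paths P"
    using grad by (simp add: canonical_gradient_def)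
next
  fix \<gamma> h assume \<gamma>: "\<gamma> \<in> paths P" and h: "has_score p \<gamma> P h"
  have in_model: "\<forall>\<^sub>F \<delta> in nhds 0. \<gamma> \<delta> \<in> \<M>"
    using assms(1,2) \<gamma> by (auto simp: path_class_def)
  have eq: "\<forall>\<^sub>F \<delta> in nhds 0. \<Phi>' (\<gamma> \<delta>) = \<Phi> (\<gamma> \<delta>) + c"
    using in_model by eventually_elim (rule shift)
  have "((\<lambda>\<delta>. \<Phi> (\<gamma> \<delta>)) has_real_derivative (\<integral>x. D x * h x \<partial>P)) (at 0)"
    using grad \<gamma> h by (auto simp: canonical_gradient_def)
  then have "((\<lambda>\<delta>. \<Phi> (\<gamma> \<delta>) + c) has_real_derivative (\<integral>x. D x * h x \<partial>P)) (at 0)"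
    by (auto intro!: derivative_eq_intros)
  then show "((\<lambda>\<delta>. \<Phi>' (\<gamma> \<delta>)) has_real_derivative (\<integral>x. D x * h x \<partial>P)) (at 0)"
    by (simp add: DERIV_cong_ev[OF refl eq refl])
qed

lemma canonical_gradient_shift:
  assumes "path_class \<M> p paths" and "P \<in> \<M>"
    and "\<And>P. P \<in> \<M> \<Longrightarrow> \<Phi>' P = \<Phi> P + c"
  shows "canonical_gradient p paths \<Phi>' P D \<longleftrightarrow> canonical_gradient p paths \<Phi> P D"
proof
  assume "canonical_gradient p paths \<Phi>' P D"
  then show "canonical_gradient p paths \<Phi> P D"
    using assms by (intro canonical_gradient_shift_imp[of \<M> p paths P \<Phi> \<Phi>' "- c"]) auto
qed (rule canonical_gradient_shift_imp[OF assms])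

lemma hal_tmle_shift:
  assumes "path_class \<M> p paths"
    and "\<And>P. P \<in> \<M> \<Longrightarrow> \<Phi>' P = \<Phi> P + c"
  shows "hal_tmle \<M> p paths Q \<Phi>' D E lf eps tol \<longleftrightarrow> hal_tmle \<M> p paths Q \<Phi> D E lf eps tol"
  using canonical_gradient_shift[OF assms(1) _ assms(2)] by (simp add: hal_tmle_def)

theorem lemma3:
  fixes \<mu> :: "'o measure" and \<M> :: "'o measure set"
    and p :: "'o measure \<Rightarrow> 'o \<Rightarrow> real"
    and \<tau> :: "real ^ 'd" and q :: "'o measure \<Rightarrow> real ^ 'd \<Rightarrow> real"
    and dens :: "(real ^ 'd \<Rightarrow> real) \<Rightarrow> 'o \<Rightarrow> real"
    and paths :: "'o measure \<Rightarrow> (real \<Rightarrow> 'o measure) set"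
    and \<Omega> :: "'w measure" and X :: "nat \<Rightarrow> 'w \<Rightarrow> 'o" and n :: nat and \<omega> :: 'w
    and B :: real
    and P0 Pn0 Pn :: "'o measure"
    and \<Psi> :: "'o measure \<Rightarrow> real" and k :: nat
    and D :: "nat \<Rightarrow> 'o measure \<Rightarrow> 'o \<Rightarrow> real"
    and E :: "nat \<Rightarrow> 'o measure \<Rightarrow> 'e::euclidean_space set"
    and lf :: "nat \<Rightarrow> 'o measure \<Rightarrow> 'e \<Rightarrow> 'o measure"
    and eps :: "nat \<Rightarrow> 'o measure \<Rightarrow> 'e"
    and tol :: "nat \<Rightarrow> real"
    and T :: "nat \<Rightarrow> 'o measure \<Rightarrow> 'o measure"
    and \<Psi>n :: "nat \<Rightarrow> 'o measure \<Rightarrow> real"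
    and R :: "nat \<Rightarrow> 'o measure \<Rightarrow> 'o measure \<Rightarrow> real"
  defines "T \<equiv> \<lambda>j P. lf j P (eps j P)"
    and "\<Psi>n \<equiv> target \<Psi> T"
    and "R \<equiv> \<lambda>j. exact_remainder (\<Psi>n (j - 1)) (D j)"
  assumes model: "dominated_model \<mu> \<M> p" "cadlag_parametrization \<M> p \<tau> q dens"
    and paths: "path_class \<M> p paths"
    and truth: "P0 \<in> \<M>"
    and iid: "prob_space \<Omega>" "0 < n" "prob_space.indep_vars \<Omega> (\<lambda>_. \<mu>) X {1..n}"
      "\<And>i. i \<in> {1..n} \<Longrightarrow> distr \<Omega> \<mu> (X i) = P0"
    and outcome: "\<omega> \<in> space \<Omega>"
    and hal: "hal_mle \<M> p \<tau> q B n (\<lambda>i. X i \<omega>) Pn"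
    and dom: "\<And>P. P \<in> \<M> \<Longrightarrow> absolutely_continuous P Pn"
    and init: "Pn0 \<in> \<M>"
    and tmle: "\<And>j. j \<in> {1..k} \<Longrightarrow>
      hal_tmle \<M> p paths Pn (\<Psi>n (j - 1)) (D j) (E j) (lf j) (eps j) (tol j)"
    and fixpoint: "\<And>j. j \<in> {1..k} \<Longrightarrow> T j Pn = Pn"
  shows
    "(\<forall>j\<in>{1..k}. \<forall>P\<in>\<M>.
        R j (T j P) Pn =
          R 1 (comp_updates T j P) Pn - (\<integral>x. D 1 (comp_updates T j P) x \<partial>Pn) + (\<integral>x. D j (T j P) x \<partial>Pn)) \<and>
     (\<forall>j\<in>{1..<k}. \<forall>P\<in>\<M>.
        R (j + 1) (T (j + 1) P) Pn =
          R j (T j (T (j + 1) P)) Pn - (\<integral>x. D j (T j (T (j + 1) P)) x \<partial>Pn)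
            + (\<integral>x. D (j + 1) (T (j + 1) P) x \<partial>Pn)) \<and>
     (\<forall>j\<in>{1..k}. \<forall>P\<in>\<M>.
        \<Psi>n j P - \<Psi>n j Pn = \<Psi>n (j - 1) (T j P) - \<Psi>n (j - 1) Pn \<and>
        \<Psi>n (j - 1) (T j P) - \<Psi>n (j - 1) Pn = - (\<integral>x. D j (T j P) x \<partial>Pn) + R j (T j P) Pn \<and>
        \<bar>(\<Psi>n j P - \<Psi>n j Pn) - R j (T j P) Pn\<bar> \<le> tol j \<and>
        ((\<integral>x. D j (T j P) x \<partial>Pn) = 0 \<longrightarrow> \<Psi>n j P - \<Psi>n j Pn = R j (T j P) Pn)) \<and>
     (\<forall>j\<in>{1..<k}.
        \<bar>(\<Psi>n j (T (j + 1) Pn0) - \<Psi>n j P0)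
           - (R j (T j (T (j + 1) Pn0)) Pn - R j (T j P0) Pn)\<bar> \<le> 2 * tol j \<and>
        ((\<forall>P\<in>\<M>. (\<integral>x. D j (T j P) x \<partial>Pn) = 0) \<longrightarrow>
           \<Psi>n j (T (j + 1) Pn0) - \<Psi>n j P0
             = R j (T j (T (j + 1) Pn0)) Pn - R j (T j P0) Pn \<and>
           hal_tmle \<M> p paths Pn (\<lambda>P. R j (T j P) Pn)
             (D (j + 1)) (E (j + 1)) (lf (j + 1)) (eps (j + 1)) (tol (j + 1)) \<and>
           (\<forall>D' (E' :: 'o measure \<Rightarrow> 'e set) lf' eps' tol'.
              hal_tmle \<M> p paths Pn (\<Psi>n j) D' E' lf' eps' tol' \<longleftrightarrow>
              hal_tmle \<M> p paths Pn (\<lambda>P. R j (T j P) Pn) D' E' lf' eps' tol')))"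
proof -
  have remainder: "R j (T j P) Pn = \<Psi>n j P - \<Psi> Pn + (\<integral>x. D j (T j P) x \<partial>Pn)"
    if "j \<in> {1..k}" for j P
    unfolding R_def \<Psi>n_def using that fixpoint by (intro exact_remainder_update) auto
  have recursion: "\<Psi>n j P = \<Psi>n (j - 1) (T j P)" if "j \<in> {1..k}" for j P
    using that by (cases j) (auto simp: \<Psi>n_def)
  have centre: "\<Psi>n j Pn = \<Psi> Pn" if "j \<le> k" for j
    unfolding \<Psi>n_def using that fixpoint by (intro target_fixed_point) auto
  have in_model: "T j P \<in> \<M>" if "j \<in> {1..k}" "P \<in> \<M>" for j P
    unfolding T_def using tmle[OF that(1)] that(2) by (rule hal_tmle_update_in_model)
  have score: "\<bar>\<integral>x. D j (T j P) x \<partial>Pn\<bar> \<le> tol j" if "j \<in> {1..k}" "P \<in> \<M>" for j P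
    unfolding T_def using tmle[OF that(1)] that(2) by (rule hal_tmle_score_bound)

  have "R j (T j P) Pn = R 1 (comp_updates T j P) Pn
      - (\<integral>x. D 1 (comp_updates T j P) x \<partial>Pn) + (\<integral>x. D j (T j P) x \<partial>Pn)"
    if "j \<in> {1..k}" for j P
  proof -
    have "R 1 (comp_updates T j P) Pn = \<Psi>n j P - \<Psi> Pn + (\<integral>x. D 1 (comp_updates T j P) x \<partial>Pn)"
      by (simp add: R_def exact_remainder_def \<Psi>n_def target_eq_comp_updates)
    then show ?thesis
      using remainder[OF that] by simp
  qed
  moreover have "R (j + 1) (T (j + 1) P) Pn = R j (T j (T (j + 1) P)) Pn
      - (\<integral>x. D j (T j (T (j + 1) P)) x \<partial>Pn) + (\<integral>x. D (j + 1) (T (j + 1) P) x \<partial>Pn)"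
    if "j \<in> {1..<k}" for j P
    using that remainder[of j "T (j + 1) P"] remainder[of "j + 1" P] recursion[of "j + 1" P]
    by simp
  moreover have "\<Psi>n j P - \<Psi>n j Pn = \<Psi>n (j - 1) (T j P) - \<Psi>n (j - 1) Pn \<and>
      \<Psi>n (j - 1) (T j P) - \<Psi>n (j - 1) Pn = - (\<integral>x. D j (T j P) x \<partial>Pn) + R j (T j P) Pn \<and>
      \<bar>(\<Psi>n j P - \<Psi>n j Pn) - R j (T j P) Pn\<bar> \<le> tol j \<and>
      ((\<integral>x. D j (T j P) x \<partial>Pn) = 0 \<longrightarrow> \<Psi>n j P - \<Psi>n j Pn = R j (T j P) Pn)"
    if "j \<in> {1..k}" "P \<in> \<M>" for j P
    using that remainder[of j P] recursion[of j P] centre[of j] centre[of "j - 1"] score[of j P]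
    by auto
  moreover have "\<bar>(\<Psi>n j (T (j + 1) Pn0) - \<Psi>n j P0)
         - (R j (T j (T (j + 1) Pn0)) Pn - R j (T j P0) Pn)\<bar> \<le> 2 * tol j"
    if "j \<in> {1..<k}" for j
    \<comment> \<open>The factor 2 counts one score term at each of the two points compared.\<close>
    using that remainder[of j "T (j + 1) Pn0"] remainder[of j P0]
      score[of j "T (j + 1) Pn0"] score[of j P0] in_model[of "j + 1" Pn0] init truth
    by (simp add: abs_le_iff)
  moreover have "\<Psi>n j (T (j + 1) Pn0) - \<Psi>n j P0
        = R j (T j (T (j + 1) Pn0)) Pn - R j (T j P0) Pn \<and>
      hal_tmle \<M> p paths Pn (\<lambda>P. R j (T j P) Pn)
        (D (j + 1)) (E (j + 1)) (lf (j + 1)) (eps (j + 1)) (tol (j + 1)) \<and>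
      (\<forall>D' (E' :: 'o measure \<Rightarrow> 'e set) lf' eps' tol'.
        hal_tmle \<M> p paths Pn (\<Psi>n j) D' E' lf' eps' tol' \<longleftrightarrow>
        hal_tmle \<M> p paths Pn (\<lambda>P. R j (T j P) Pn) D' E' lf' eps' tol')"
    if j: "j \<in> {1..<k}" and solved: "\<forall>P\<in>\<M>. (\<integral>x. D j (T j P) x \<partial>Pn) = 0" for j
  proof -
    have shift: "R j (T j P) Pn = \<Psi>n j P + (- \<Psi> Pn)" if "P \<in> \<M>" for P
      using j solved that remainder[of j P] by simp
    have same_tmles: "hal_tmle \<M> p paths Pn (\<lambda>P. R j (T j P) Pn) D' E' lf' eps' tol' \<longleftrightarrow>
        hal_tmle \<M> p paths Pn (\<Psi>n j) D' E' lf' eps' tol'"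
      for D' and E' :: "'o measure \<Rightarrow> 'e set" and lf' eps' tol'
      by (rule hal_tmle_shift[OF paths shift])
    have "hal_tmle \<M> p paths Pn (\<Psi>n j)
        (D (j + 1)) (E (j + 1)) (lf (j + 1)) (eps (j + 1)) (tol (j + 1))"
      using tmle[of "j + 1"] j by simp
    moreover have "T (j + 1) Pn0 \<in> \<M>"
      using in_model[of "j + 1" Pn0] j init by simp
    ultimately show ?thesis
      using shift truth by (simp add: same_tmles)
  qed
  ultimately show ?thesis
    by blast
qed

end
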